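(* Let $F(z)=1+F_1z+F_2z^2+F_3z^3+\cdots$ be any formal power series (with complex coefficients) with $F(0)=1$. Then the polynomials $$F_n(x)=[z^n]\,F(z)^x,\qquad n\ge 0,$$ form a convolution family. Conversely, every convolution family $F_0(x),F_1(x),F_2(x),\ldots$ either arises in this way from some power series $F(z)$ with $F(0)=1$, or is identically zero (that is, $F_n(x)=0$ for all $n$).
   Context: A family of polynomials $F_0(x),F_1(x),F_2(x),\ldots$ (with complex coefficients) is a convolution family if $F_n(x)$ has degree $\le n$ and $$F_n(x+y)=\sum_{k=0}^n F_{n-k}(x)\,F_k(y)$$ holds for all $x$ and $y$ and for all $n\ge 0$. The notation $[z^n]$ denotes the coefficient of $z^n$, and $F(z)^x=\exp(x\ln F(z))$ as a formal power series in $z$, where $\ln F(z)$ has zero constant term. *)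

theory Defs
  imports Complex_Main "HOL-Computational_Algebra.Computational_Algebra"
begin

definition convolution_family :: "(nat \<Rightarrow> complex poly) \<Rightarrow> bool" where
  "convolution_family p \<longleftrightarrow>
     (\<forall>n. degree (p n) \<le> n) \<and>
     (\<forall>n x y. poly (p n) (x + y) = (\<Sum>k=0..n. poly (p (n - k)) x * poly (p k) y))"

(* fps_ln 1 is the series ln (1 + z), so the logarithm of F is its composition with F - 1.
   Both definitions are meaningful only if F has constant term 1: fps_compose
   is substitution only when the inner series has zero constant term. *)
definition fps_log :: "complex fps \<Rightarrow> complex fps" where
  "fps_log F = fps_ln 1 oo (F - 1)"

definition fps_cpow :: "complex fps \<Rightarrow> complex \<Rightarrow> complex fps" where
  "fps_cpow F x = fps_exp 1 oo (fps_const x * fps_log F)"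

definition power_coeff_polys :: "complex fps \<Rightarrow> (nat \<Rightarrow> complex poly) \<Rightarrow> bool" where
  "power_coeff_polys F p \<longleftrightarrow> (\<forall>n x. poly (p n) x = fps_cpow F x $ n)"

end

theory Submission
  imports Defs
begin

text \<open>
  Let \<open>G x\<close> be the generating function of the values \<open>p n x\<close>. Then \<open>p\<close> satisfies the convolution
  identity iff \<open>G (x + y) = G x * G y\<close>, which for \<open>G x = F\<^sup>x\<close> is the law of exponents. Conversely,
  \<open>G 0\<close> is idempotent, so it is \<open>0\<close>, whence \<open>G x = G x * G 0 = 0\<close>, or it is \<open>1\<close>. In the latter case
  put \<open>F = G 1\<close>: the coefficients of \<open>G x\<close> and \<open>F\<^sup>x\<close> are polynomials in \<open>x\<close> that agree at
  every natural number, hence everywhere.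
\<close>

lemma fps_mult_nth_rev:
  fixes f g :: "'a::comm_semiring_1 fps"
  shows "(f * g) $ n = (\<Sum>k=0..n. f $ (n - k) * g $ k)"
  using fps_mult_nth[of g f n] by (simp only: mult.commute)

lemma fps_log_nth_0 [simp]: "fps_log F $ 0 = 0"
  by (simp add: fps_log_def fps_ln_def)

text \<open>Multiplying by \<open>x\<close> is composing with the series
  \<open>fps_const x * fps_X\<close>, so associativity moves the scalar into the exponential. The
  outer series then carries all dependence on \<open>x\<close>.\<close>

lemma fps_cpow_eq_compose: "fps_cpow F x = fps_exp x oo fps_log F"
proof -
  have "fps_cpow F x = fps_exp 1 oo ((fps_const x * fps_X) oo fps_log F)"
    by (simp add: fps_cpow_def fps_compose_mult_distrib)
  also have "\<dots> = (fps_exp 1 oo (fps_const x * fps_X)) oo fps_log F"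
    by (rule fps_compose_assoc) simp_all
  finally show ?thesis
    by simp
qed

lemma fps_cpow_0 [simp]: "fps_cpow F 0 = 1"
  by (simp add: fps_cpow_eq_compose)

lemma fps_cpow_add: "fps_cpow F (x + y) = fps_cpow F x * fps_cpow F y"
  by (simp add: fps_cpow_eq_compose fps_exp_add_mult fps_compose_mult_distrib)

text \<open>\<open>fps_ln 1\<close> is the compositional inverse of
  \<open>fps_exp 1 - 1\<close>.\<close>

lemma fps_exp_compose_fps_ln: "fps_exp 1 oo fps_ln 1 = (1 + fps_X :: complex fps)"
proof -
  have "(fps_exp 1 - 1) oo fps_ln 1 = (fps_X :: complex fps)"
    using fps_inv_right[of "fps_exp 1 - 1 :: complex fps"]
    by (simp add: fps_ln_fps_exp_inv)
  then show ?thesis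
    by (simp add: fps_compose_sub_distrib algebra_simps)
qed

lemma fps_cpow_1:
  assumes "F $ 0 = 1"
  shows "fps_cpow F 1 = F"
proof -
  have "fps_cpow F 1 = (fps_exp 1 oo fps_ln 1) oo (F - 1)"
    unfolding fps_cpow_eq_compose fps_log_def
    by (rule fps_compose_assoc) (use assms in \<open>simp_all add: fps_ln_def\<close>)
  also have "\<dots> = F"
    using assms by (simp add: fps_exp_compose_fps_ln fps_compose_add_distrib)
  finally show ?thesis .
qed

lemma fps_cpow_of_nat:
  assumes "F $ 0 = 1"
  shows "fps_cpow F (of_nat m) = F ^ m"
  by (induction m) (simp_all add: assms fps_cpow_add fps_cpow_1)

text \<open>With \<open>L = fps_log F\<close>, this is the coefficient at \<open>n\<close> of the
  sum of \<open>x^i * L^i / i!\<close>. Stopping at \<open>i = n\<close> loses nothing: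
  \<open>L\<close> has zero constant term, so \<open>L^i\<close> has no terms below degree
  \<open>i\<close>.\<close>

definition cpow_poly :: "complex fps \<Rightarrow> nat \<Rightarrow> complex poly" where
  "cpow_poly F n = (\<Sum>i=0..n. monom ((fps_log F ^ i) $ n / fact i) i)"

lemma poly_cpow_poly: "poly (cpow_poly F n) x = fps_cpow F x $ n"
  by (simp add: cpow_poly_def fps_cpow_eq_compose fps_compose_nth poly_sum poly_monom
      mult.commute)

lemma degree_cpow_poly_le: "degree (cpow_poly F n) \<le> n"
  unfolding cpow_poly_def
  by (intro degree_sum_le) (auto intro: order_trans[OF degree_monom_le])

lemma convolution_family_cpow_poly: "convolution_family (cpow_poly F)"
  by (simp add: convolution_family_def degree_cpow_poly_le poly_cpow_poly fps_cpow_add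
      fps_mult_nth_rev)

text \<open>Otherwise the nonzero difference would have infinitely many roots.\<close>

lemma poly_eqI_of_nat:
  fixes p q :: "'a::{idom,ring_char_0} poly"
  assumes "\<And>m. poly p (of_nat m) = poly q (of_nat m)"
  shows "p = q"
proof (rule ccontr)
  assume "p \<noteq> q"
  then have "finite {x. poly (p - q) x = 0}"
    by (intro poly_roots_finite) simp
  moreover have "range of_nat \<subseteq> {x. poly (p - q) x = 0}"
    using assms by auto
  ultimately show False
    using finite_subset infinite_UNIV_char_0 finite_imageD[OF _ inj_of_nat] infinite_UNIV_nat
    by metis
qed

definition family_gf :: "(nat \<Rightarrow> complex poly) \<Rightarrow> complex \<Rightarrow> complex fps" where
  "family_gf p x = Abs_fps (\<lambda>n. poly (p n) x)"

lemma family_gf_nth [simp]: "family_gf p x $ n = poly (p n) x"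
  by (simp add: family_gf_def)

lemma family_gf_add:
  assumes "convolution_family p"
  shows "family_gf p (x + y) = family_gf p x * family_gf p y"
  using assms unfolding convolution_family_def fps_eq_iff fps_mult_nth_rev family_gf_nth by blast

text \<open>Formal power series over the complex numbers form an integral domain, so 0 and 1 are the
  only idempotents.\<close>

lemma family_gf_0_cases:
  assumes "convolution_family p"
  shows "family_gf p 0 = 0 \<or> family_gf p 0 = 1"
  using family_gf_add[OF assms, of 0 0] by simp

lemma family_gf_of_nat:
  assumes "convolution_family p" and "family_gf p 0 = 1"
  shows "family_gf p (of_nat m) = family_gf p 1 ^ m"
  by (induction m) (simp_all add: assms family_gf_add)

text \<open>The degree bound at \<open>n = 0\<close> makes \<open>p 0\<close> constant, so its value
  at 0 is its value everywhere. At \<open>x = 1\<close> this makes \<open>family_gf p 1\<close> an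
  admissible base for powers.\<close>

lemma family_gf_nth_0:
  assumes "convolution_family p" and "family_gf p 0 = 1"
  shows "family_gf p x $ 0 = 1"
proof -
  from assms(1) have "degree (p 0) \<le> 0"
    unfolding convolution_family_def by blast
  then have "degree (p 0) = 0"
    by simp
  then obtain c where "p 0 = [:c:]"
    by (rule degree_eq_zeroE)
  moreover have "family_gf p 0 $ 0 = 1"
    using assms(2) by simp
  ultimately show ?thesis
    by simp
qed

lemma convolution_family_eq_cpow_poly:
  assumes "convolution_family p" and "family_gf p 0 = 1"
  shows "p n = cpow_poly (family_gf p 1) n"
proof (rule poly_eqI_of_nat)
  fix m
  have "poly (p n) (of_nat m) = family_gf p (of_nat m) $ n"
    by simp
  \<comment> \<open>Both series equal the ordinary power \<open>family_gf p 1 ^ m\<close>.\<close>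
  also have "\<dots> = fps_cpow (family_gf p 1) (of_nat m) $ n"
    using assms by (simp only: family_gf_of_nat fps_cpow_of_nat family_gf_nth_0)
  finally show "poly (p n) (of_nat m) = poly (cpow_poly (family_gf p 1) n) (of_nat m)"
    by (simp only: poly_cpow_poly)
qed

lemma convolution_family_eq_0:
  assumes "convolution_family p" and "family_gf p 0 = 0"
  shows "p n = 0"
proof -
  have "family_gf p x = 0" for x
    using family_gf_add[OF assms(1), of x 0] assms(2) by simp
  then have "poly (p n) x = 0" for x
    by (metis family_gf_nth fps_zero_nth)
  then show ?thesis
    using poly_all_0_iff_0 by blast
qed

theorem mainTheorem3:
  shows "(\<forall>F :: complex fps. F $ 0 = 1 \<longrightarrow>
            (\<exists>p. power_coeff_polys F p \<and> convolution_family p)) \<and>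
         (\<forall>p :: nat \<Rightarrow> complex poly. convolution_family p \<longrightarrow>
            (\<exists>F :: complex fps. F $ 0 = 1 \<and> power_coeff_polys F p) \<or> (\<forall>n. p n = 0))"
proof (intro conjI allI impI)
  fix F :: "complex fps"
  show "\<exists>p. power_coeff_polys F p \<and> convolution_family p"
    using convolution_family_cpow_poly poly_cpow_poly unfolding power_coeff_polys_def by blast
next
  fix p :: "nat \<Rightarrow> complex poly"
  assume conv: "convolution_family p"
  from family_gf_0_cases[OF conv]
  show "(\<exists>F :: complex fps. F $ 0 = 1 \<and> power_coeff_polys F p) \<or> (\<forall>n. p n = 0)"
  proof
    assume "family_gf p 0 = 0"
    then show ?thesis
      using convolution_family_eq_0[OF conv] by blast
  next
    assume one: "family_gf p 0 = 1"
    have "power_coeff_polys (family_gf p 1) p"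
      unfolding power_coeff_polys_def
      using convolution_family_eq_cpow_poly[OF conv one] poly_cpow_poly by metis
    then show ?thesis
      using family_gf_nth_0[OF conv one] by blast
  qed
qed

end
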